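(* Let $\mathcal A$ be an abelian length category. The Gabriel-Roiter measure $\ell^*\colon\mathrm{ind}\,\mathcal A\to\mathrm{Ch}(\mathbb N)$ induces via $$\mu(X)\leq\mu(Y)\quad:\Longleftrightarrow\quad\ell^*(X)\leq\ell^*(Y)\quad\text{for}\quad X,Y\in\mathrm{ind}\,\mathcal A$$ a relation on $\mathrm{ind}\,\mathcal A$. This is the unique transitive relation on $\mathrm{ind}\,\mathcal A$ (written $\mu(X)\leq\mu(Y)$) satisfying for all objects $X,Y$ in $\mathrm{ind}\,\mathcal A$ the following: (GR1) $X\subseteq Y$ implies $\mu(X)\leq\mu(Y)$. (GR2) $\mu(X)=\mu(Y)$ implies $\ell(X)=\ell(Y)$. (GR3) If $\mu(X')<\mu(Y)$ for all $X'\in\mathrm{ind}\,\mathcal A$ with $X'\subset X$, and $\ell(X)\geq\ell(Y)$, then $\mu(X)\leq\mu(Y)$.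
   Context: An abelian length category is an abelian category in which every object has finite length (i.e. a finite composition series) and whose isomorphism classes of objects form a set. $\ell(X)$ denotes the composition length of $X$, and $\mathrm{ind}\,\mathcal A$ the set of isomorphism classes of indecomposable objects. Isomorphism classes of objects are partially ordered by: $X\subseteq Y$ if and only if there exists a monomorphism $X\to Y$; $X\subset Y$ means $X\subseteq Y$ and $X\not\cong Y$. $\mathbb N=\{1,2,\ldots\}$; $\mathrm{Ch}(\mathbb N)$ is the set of finite subsets of $\mathbb N$, totally ordered by the lexicographic order: $A\leq B$ if and only if $\min(B\setminus A)\leq\min(A\setminus B)$, with the convention that $\min\emptyset$ is larger than every $n\in\mathbb N$. The Gabriel-Roiter measure for $\mathcal A$ is the map $\ell^*\colon\mathrm{ind}\,\mathcal A\to\mathrm{Ch}(\mathbb N)$ sending $X$ to the lexicographic maximum of the sets $\{\ell(X_1),\ldots,\ell(X_n)\}$ over all finite chains $X_1\subset X_2\subset\cdots\subset X_n=X$ in $\mathrm{ind}\,\mathcal A$. Convention: for a relation written $\mu(X)\leq\mu(Y)$, one writes $\mu(X)=\mu(Y)$ if both $\mu(X)\leq\mu(Y)$ and $\mu(Y)\leq\mu(X)$ hold, and $\mu(X)<\mu(Y)$ if $\mu(X)\leq\mu(Y)$ holds and $\mu(X)=\mu(Y)$ does not hold. *)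

theory Defs
  imports Main "HOL-Algebra.Group" "HOL-Library.Extended_Nat"
begin

section \<open>Categories\<close>

record ('o, 'm) cat =
  Obj :: "'o set"
  Arr :: "'m set"
  Dom :: "'m \<Rightarrow> 'o"
  Cod :: "'m \<Rightarrow> 'o"
  Ident :: "'o \<Rightarrow> 'm"
  Comp :: "'m \<Rightarrow> 'm \<Rightarrow> 'm"  (infixl \<open>\<cdot>\<index>\<close> 70)

definition Hom :: "('o, 'm, 'z) cat_scheme \<Rightarrow> 'o \<Rightarrow> 'o \<Rightarrow> 'm set" where
  "Hom C X Y = {f \<in> Arr C. Dom C f = X \<and> Cod C f = Y}"

locale category =
  fixes C :: "('o, 'm, 'z) cat_scheme" (structure)
  assumes Dom_in_Obj: "f \<in> Arr C \<Longrightarrow> Dom C f \<in> Obj C"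
    and Cod_in_Obj: "f \<in> Arr C \<Longrightarrow> Cod C f \<in> Obj C"
    and Ident_in_Hom: "X \<in> Obj C \<Longrightarrow> Ident C X \<in> Hom C X X"
    and Comp_in_Hom: "\<lbrakk>f \<in> Hom C X Y; g \<in> Hom C Y Z\<rbrakk> \<Longrightarrow> g \<cdot> f \<in> Hom C X Z"
    and Comp_Ident_left: "f \<in> Hom C X Y \<Longrightarrow> Ident C Y \<cdot> f = f"
    and Comp_Ident_right: "f \<in> Hom C X Y \<Longrightarrow> f \<cdot> Ident C X = f"
    and Comp_assoc: "\<lbrakk>f \<in> Hom C W X; g \<in> Hom C X Y; h \<in> Hom C Y Z\<rbrakk>
      \<Longrightarrow> (h \<cdot> g) \<cdot> f = h \<cdot> (g \<cdot> f)"

definition mono_arr :: "('o, 'm, 'z) cat_scheme \<Rightarrow> 'm \<Rightarrow> bool" where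
  "mono_arr C f \<longleftrightarrow> f \<in> Arr C \<and>
    (\<forall>W. \<forall>g \<in> Hom C W (Dom C f). \<forall>h \<in> Hom C W (Dom C f).
      f \<cdot>\<^bsub>C\<^esub> g = f \<cdot>\<^bsub>C\<^esub> h \<longrightarrow> g = h)"

definition epi_arr :: "('o, 'm, 'z) cat_scheme \<Rightarrow> 'm \<Rightarrow> bool" where
  "epi_arr C f \<longleftrightarrow> f \<in> Arr C \<and>
    (\<forall>Z. \<forall>g \<in> Hom C (Cod C f) Z. \<forall>h \<in> Hom C (Cod C f) Z.
      g \<cdot>\<^bsub>C\<^esub> f = h \<cdot>\<^bsub>C\<^esub> f \<longrightarrow> g = h)"

definition iso_arr :: "('o, 'm, 'z) cat_scheme \<Rightarrow> 'm \<Rightarrow> bool" where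
  "iso_arr C f \<longleftrightarrow> f \<in> Arr C \<and>
    (\<exists>g \<in> Hom C (Cod C f) (Dom C f).
      g \<cdot>\<^bsub>C\<^esub> f = Ident C (Dom C f) \<and> f \<cdot>\<^bsub>C\<^esub> g = Ident C (Cod C f))"

definition isomorphic :: "('o, 'm, 'z) cat_scheme \<Rightarrow> 'o \<Rightarrow> 'o \<Rightarrow> bool" where
  "isomorphic C X Y \<longleftrightarrow> X \<in> Obj C \<and> Y \<in> Obj C \<and> (\<exists>f \<in> Hom C X Y. iso_arr C f)"

definition zero_object :: "('o, 'm, 'z) cat_scheme \<Rightarrow> 'o \<Rightarrow> bool" where
  "zero_object C Z \<longleftrightarrow> Z \<in> Obj C \<and>
    (\<forall>X \<in> Obj C. (\<exists>!f. f \<in> Hom C X Z) \<and> (\<exists>!f. f \<in> Hom C Z X))"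


section \<open>Abelian categories\<close>

text \<open>Definition of Mac Lane, Categories for the Working Mathematician, VIII.3: the additive
  structure on the Hom sets is part of the data.\<close>

record ('o, 'm) ab_cat = "('o, 'm) cat" +
  Add :: "'m \<Rightarrow> 'm \<Rightarrow> 'm"  (infixl \<open>\<oplus>\<index>\<close> 65)
  Zero :: "'o \<Rightarrow> 'o \<Rightarrow> 'm"

definition Hom_group :: "('o, 'm, 'z) ab_cat_scheme \<Rightarrow> 'o \<Rightarrow> 'o \<Rightarrow> 'm monoid" where
  "Hom_group C X Y = \<lparr>carrier = Hom C X Y, mult = Add C, one = Zero C X Y\<rparr>"

locale preadditive_category = category C
  for C :: "('o, 'm, 'z) ab_cat_scheme" (structure) +
  assumes Hom_comm_group: "\<lbrakk>X \<in> Obj C; Y \<in> Obj C\<rbrakk> \<Longrightarrow> comm_group (Hom_group C X Y)"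
    and Comp_Add_left: "\<lbrakk>f \<in> Hom C X Y; g \<in> Hom C Y Z; h \<in> Hom C Y Z\<rbrakk>
      \<Longrightarrow> (g \<oplus> h) \<cdot> f = g \<cdot> f \<oplus> h \<cdot> f"
    and Comp_Add_right: "\<lbrakk>f \<in> Hom C X Y; g \<in> Hom C X Y; h \<in> Hom C Y Z\<rbrakk>
      \<Longrightarrow> h \<cdot> (f \<oplus> g) = h \<cdot> f \<oplus> h \<cdot> g"

definition kernel_of :: "('o, 'm, 'z) ab_cat_scheme \<Rightarrow> 'm \<Rightarrow> 'm \<Rightarrow> bool" where
  "kernel_of C f k \<longleftrightarrow> f \<in> Arr C \<and> k \<in> Arr C \<and> Cod C k = Dom C f \<and>
    f \<cdot>\<^bsub>C\<^esub> k = Zero C (Dom C k) (Cod C f) \<and>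
    (\<forall>W. \<forall>h \<in> Hom C W (Dom C f). f \<cdot>\<^bsub>C\<^esub> h = Zero C W (Cod C f) \<longrightarrow>
      (\<exists>!u. u \<in> Hom C W (Dom C k) \<and> k \<cdot>\<^bsub>C\<^esub> u = h))"

definition cokernel_of :: "('o, 'm, 'z) ab_cat_scheme \<Rightarrow> 'm \<Rightarrow> 'm \<Rightarrow> bool" where
  "cokernel_of C f c \<longleftrightarrow> f \<in> Arr C \<and> c \<in> Arr C \<and> Dom C c = Cod C f \<and>
    c \<cdot>\<^bsub>C\<^esub> f = Zero C (Dom C f) (Cod C c) \<and>
    (\<forall>W. \<forall>h \<in> Hom C (Cod C f) W. h \<cdot>\<^bsub>C\<^esub> f = Zero C (Dom C f) W \<longrightarrow>
      (\<exists>!u. u \<in> Hom C (Cod C c) W \<and> u \<cdot>\<^bsub>C\<^esub> c = h))"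

definition biproduct ::
    "('o, 'm, 'z) ab_cat_scheme \<Rightarrow> 'o \<Rightarrow> 'o \<Rightarrow> 'o \<Rightarrow> 'm \<Rightarrow> 'm \<Rightarrow> 'm \<Rightarrow> 'm \<Rightarrow> bool" where
  "biproduct C A B X i j p q \<longleftrightarrow>
    i \<in> Hom C A X \<and> j \<in> Hom C B X \<and> p \<in> Hom C X A \<and> q \<in> Hom C X B \<and>
    p \<cdot>\<^bsub>C\<^esub> i = Ident C A \<and> q \<cdot>\<^bsub>C\<^esub> j = Ident C B \<and>
    p \<cdot>\<^bsub>C\<^esub> j = Zero C B A \<and> q \<cdot>\<^bsub>C\<^esub> i = Zero C A B \<and>
    (i \<cdot>\<^bsub>C\<^esub> p) \<oplus>\<^bsub>C\<^esub> (j \<cdot>\<^bsub>C\<^esub> q) = Ident C X"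

locale abelian_category = preadditive_category +
  assumes zero_object_exists: "\<exists>Z. zero_object C Z"
    and biproduct_exists: "\<lbrakk>A \<in> Obj C; B \<in> Obj C\<rbrakk> \<Longrightarrow> \<exists>X i j p q. biproduct C A B X i j p q"
    and kernel_exists: "f \<in> Arr C \<Longrightarrow> \<exists>k. kernel_of C f k"
    and cokernel_exists: "f \<in> Arr C \<Longrightarrow> \<exists>c. cokernel_of C f c"
    and mono_is_kernel: "mono_arr C k \<Longrightarrow> \<exists>f. kernel_of C f k"
    and epi_is_cokernel: "epi_arr C c \<Longrightarrow> \<exists>f. cokernel_of C f c"


section \<open>Length and indecomposable objects\<close>

definition simple_object :: "('o, 'm, 'z) ab_cat_scheme \<Rightarrow> 'o \<Rightarrow> bool" where
  "simple_object C X \<longleftrightarrow> X \<in> Obj C \<and> \<not> zero_object C X \<and>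
    (\<forall>Y. \<forall>f \<in> Hom C Y X. mono_arr C f \<longrightarrow> zero_object C Y \<or> iso_arr C f)"

text \<open>A series \<open>0 = X\<^sub>0 \<rightarrow> X\<^sub>1 \<rightarrow> \<dots> \<rightarrow> X\<^sub>n = X\<close> of monomorphisms with simple cokernels.\<close>

inductive has_composition_series :: "('o, 'm, 'z) ab_cat_scheme \<Rightarrow> 'o \<Rightarrow> nat \<Rightarrow> bool"
  for C where
  zero: "zero_object C X \<Longrightarrow> has_composition_series C X 0"
| step: "\<lbrakk>has_composition_series C X n; f \<in> Hom C X Y; mono_arr C f;
     cokernel_of C f c; simple_object C (Cod C c)\<rbrakk> \<Longrightarrow> has_composition_series C Y (Suc n)"

text \<open>Isomorphism classes of objects form a set automatically, since \<open>Obj C\<close> is a set.\<close>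

locale abelian_length_category = abelian_category +
  assumes finite_length: "X \<in> Obj C \<Longrightarrow> \<exists>n. has_composition_series C X n"

text \<open>All composition series of an object have the same length, by Jordan--Hoelder.\<close>

definition obj_length :: "('o, 'm, 'z) ab_cat_scheme \<Rightarrow> 'o \<Rightarrow> nat" where
  "obj_length C X = (THE n. has_composition_series C X n)"

definition indecomposable :: "('o, 'm, 'z) ab_cat_scheme \<Rightarrow> 'o \<Rightarrow> bool" where
  "indecomposable C X \<longleftrightarrow> X \<in> Obj C \<and> \<not> zero_object C X \<and>
    (\<forall>A B i j p q. biproduct C A B X i j p q \<longrightarrow> zero_object C A \<or> zero_object C B)"


section \<open>Isomorphism classes\<close>

definition iso_class :: "('o, 'm, 'z) cat_scheme \<Rightarrow> 'o \<Rightarrow> 'o set" where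
  "iso_class C X = {Y. isomorphic C X Y}"

definition ind :: "('o, 'm, 'z) ab_cat_scheme \<Rightarrow> 'o set set" where
  "ind C = iso_class C ` {X. indecomposable C X}"

text \<open>In the following, \<open>X\<close> and \<open>Y\<close> are isomorphism classes, so \<open>X \<noteq> Y\<close> says that
  representatives are not isomorphic.\<close>

definition cls_sub :: "('o, 'm, 'z) cat_scheme \<Rightarrow> 'o set \<Rightarrow> 'o set \<Rightarrow> bool" where
  "cls_sub C X Y \<longleftrightarrow> (\<exists>x \<in> X. \<exists>y \<in> Y. \<exists>f \<in> Hom C x y. mono_arr C f)"

definition cls_ssub :: "('o, 'm, 'z) cat_scheme \<Rightarrow> 'o set \<Rightarrow> 'o set \<Rightarrow> bool" where
  "cls_ssub C X Y \<longleftrightarrow> cls_sub C X Y \<and> X \<noteq> Y"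

definition cls_length :: "('o, 'm, 'z) ab_cat_scheme \<Rightarrow> 'o set \<Rightarrow> nat" where
  "cls_length C X = obj_length C (SOME x. x \<in> X)"


section \<open>The Gabriel-Roiter measure\<close>

definition Ch :: "nat set set" where
  "Ch = {A. finite A \<and> 0 \<notin> A}"

text \<open>The infimum in \<^typ>\<open>enat\<close> is the minimum for nonempty sets and \<open>\<infinity>\<close> for the empty set.\<close>

definition lex_le :: "nat set \<Rightarrow> nat set \<Rightarrow> bool" where
  "lex_le A B \<longleftrightarrow> (INF n \<in> B - A. enat n) \<le> (INF n \<in> A - B. enat n)"

definition ind_chain :: "('o, 'm, 'z) ab_cat_scheme \<Rightarrow> 'o set list \<Rightarrow> 'o set \<Rightarrow> bool" where
  "ind_chain C Xs X \<longleftrightarrow> Xs \<noteq> [] \<and> set Xs \<subseteq> ind C \<and> successively (cls_ssub C) Xs \<and> last Xs = X"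

definition chain_lengths :: "('o, 'm, 'z) ab_cat_scheme \<Rightarrow> 'o set \<Rightarrow> nat set set" where
  "chain_lengths C X = {cls_length C ` set Xs | Xs. ind_chain C Xs X}"

definition GR_measure :: "('o, 'm, 'z) ab_cat_scheme \<Rightarrow> 'o set \<Rightarrow> nat set" where
  "GR_measure C X =
    (THE M. M \<in> chain_lengths C X \<and> (\<forall>N \<in> chain_lengths C X. lex_le N M))"

text \<open>For a relation \<open>R\<close>, read \<open>(X, Y) \<in> R\<close> as \<open>\<mu>(X) \<le> \<mu>(Y)\<close>.\<close>

definition GR_rel :: "('o, 'm, 'z) ab_cat_scheme \<Rightarrow> 'o set rel" where
  "GR_rel C = {(X, Y) \<in> ind C \<times> ind C. lex_le (GR_measure C X) (GR_measure C Y)}"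

definition mu_eq :: "'a rel \<Rightarrow> 'a \<Rightarrow> 'a \<Rightarrow> bool" where
  "mu_eq R X Y \<longleftrightarrow> (X, Y) \<in> R \<and> (Y, X) \<in> R"

definition mu_less :: "'a rel \<Rightarrow> 'a \<Rightarrow> 'a \<Rightarrow> bool" where
  "mu_less R X Y \<longleftrightarrow> (X, Y) \<in> R \<and> \<not> mu_eq R X Y"

definition GR1 :: "('o, 'm, 'z) ab_cat_scheme \<Rightarrow> 'o set rel \<Rightarrow> bool" where
  "GR1 C R \<longleftrightarrow> (\<forall>X \<in> ind C. \<forall>Y \<in> ind C. cls_sub C X Y \<longrightarrow> (X, Y) \<in> R)"

definition GR2 :: "('o, 'm, 'z) ab_cat_scheme \<Rightarrow> 'o set rel \<Rightarrow> bool" where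
  "GR2 C R \<longleftrightarrow> (\<forall>X \<in> ind C. \<forall>Y \<in> ind C.
    mu_eq R X Y \<longrightarrow> cls_length C X = cls_length C Y)"

definition GR3 :: "('o, 'm, 'z) ab_cat_scheme \<Rightarrow> 'o set rel \<Rightarrow> bool" where
  "GR3 C R \<longleftrightarrow> (\<forall>X \<in> ind C. \<forall>Y \<in> ind C.
    (\<forall>X' \<in> ind C. cls_ssub C X' X \<longrightarrow> mu_less R X' Y) \<and> cls_length C X \<ge> cls_length C Y
      \<longrightarrow> (X, Y) \<in> R)"

end

(* A composition series can be pulled back along a monomorphism, so the length is well defined
   and strictly increases along monomorphisms that are not isomorphisms. Hence the lexicographic
   maximum mu(X) exists and is mu(X') together with l(X) for some proper X', or just l(X), with
   l(X) as largest element.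

   For uniqueness, compare X and Y by induction on l(X) + l(Y), where mu(Y) = B + l(Y) and B is
   empty or mu(Y'). If mu(X) <= B, then B = mu(Y') and the relation follows from the one between
   X and Y' together with (GR1). Otherwise mu(X) <= mu(Y) forces l(X) >= l(Y), and the induction
   hypothesis for the proper subobjects of X makes (GR3) applicable. *)

theory Submission imports Defs begin

section \<open>Categories\<close>

context category
begin

lemma HomD:
  assumes "f \<in> Hom C X Y"
  shows "f \<in> Arr C" "Dom C f = X" "Cod C f = Y" "X \<in> Obj C" "Y \<in> Obj C"
  using assms Dom_in_Obj Cod_in_Obj by (auto simp: Hom_def)

lemma Arr_in_Hom: "f \<in> Arr C \<Longrightarrow> f \<in> Hom C (Dom C f) (Cod C f)"
  by (simp add: Hom_def)

lemma mono_arr_cancel: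
  assumes "mono_arr C f" "f \<in> Hom C X Y" "g \<in> Hom C W X" "h \<in> Hom C W X" "f \<cdot> g = f \<cdot> h"
  shows "g = h"
  using assms HomD[OF assms(2)] by (auto simp: mono_arr_def)

lemma mono_arr_right_factor:
  assumes "g \<in> Hom C X Y" "f \<in> Hom C Y Z" "mono_arr C (f \<cdot> g)"
  shows "mono_arr C g"
  unfolding mono_arr_def
proof (intro conjI allI ballI impI)
  show "g \<in> Arr C" using assms HomD(1,4,5) by blast
  fix W a b
  assume a: "a \<in> Hom C W (Dom C g)" and b: "b \<in> Hom C W (Dom C g)" and e: "g \<cdot> a = g \<cdot> b"
  have "a \<in> Hom C W X" "b \<in> Hom C W X" using a b HomD(2)[OF assms(1)] by auto
  moreover from this have "(f \<cdot> g) \<cdot> a = (f \<cdot> g) \<cdot> b"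
    using e assms Comp_assoc by metis
  ultimately show "a = b"
    using mono_arr_cancel[OF assms(3) Comp_in_Hom[OF assms(1,2)]] by blast
qed

lemma mono_arr_Comp:
  assumes "g \<in> Hom C X Y" "f \<in> Hom C Y Z" "mono_arr C g" "mono_arr C f"
  shows "mono_arr C (f \<cdot> g)"
  unfolding mono_arr_def
proof (intro conjI allI ballI impI)
  have h: "f \<cdot> g \<in> Hom C X Z" using assms Comp_in_Hom by blast
  show "f \<cdot> g \<in> Arr C" using h HomD(1,4,5) by blast
  fix W a b
  assume "a \<in> Hom C W (Dom C (f \<cdot> g))" "b \<in> Hom C W (Dom C (f \<cdot> g))"
    and e: "(f \<cdot> g) \<cdot> a = (f \<cdot> g) \<cdot> b"
  then have ab: "a \<in> Hom C W X" "b \<in> Hom C W X" using HomD(2)[OF h] by auto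
  then have "f \<cdot> (g \<cdot> a) = f \<cdot> (g \<cdot> b)" using e assms Comp_assoc by metis
  then have "g \<cdot> a = g \<cdot> b"
    using mono_arr_cancel[OF assms(4,2)] ab assms(1) Comp_in_Hom by blast
  then show "a = b" using mono_arr_cancel[OF assms(3,1)] ab by blast
qed

section \<open>Isomorphisms and isomorphic objects\<close>

lemma iso_arrE:
  assumes "iso_arr C f" "f \<in> Hom C X Y"
  obtains g where "g \<in> Hom C Y X" "g \<cdot> f = Ident C X" "f \<cdot> g = Ident C Y"
  using assms HomD[OF assms(2)] by (auto simp: iso_arr_def)

lemma iso_arrI:
  assumes "f \<in> Hom C X Y" "g \<in> Hom C Y X" "g \<cdot> f = Ident C X" "f \<cdot> g = Ident C Y"
  shows "iso_arr C f"
  using assms HomD[OF assms(1)] by (auto simp: iso_arr_def)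

lemma mono_arr_Ident:
  assumes "X \<in> Obj C"
  shows "mono_arr C (Ident C X)"
proof -
  have "Ident C X \<in> Hom C X X" using assms by (rule Ident_in_Hom)
  then show ?thesis unfolding mono_arr_def
    using Comp_Ident_left HomD[of "Ident C X" X X] by metis
qed

text \<open>Composing with the inverse gives an identity, which is mono, and a right factor of a
  mono is mono.\<close>

lemma iso_arr_imp_mono_arr:
  assumes "iso_arr C f"
  shows "mono_arr C f"
proof -
  have f: "f \<in> Hom C (Dom C f) (Cod C f)" using assms by (auto simp: iso_arr_def Arr_in_Hom)
  obtain g where g: "g \<in> Hom C (Cod C f) (Dom C f)" "g \<cdot> f = Ident C (Dom C f)"
    using iso_arrE[OF assms f] by blast
  show ?thesis
    using mono_arr_right_factor[OF f g(1)] g(2) mono_arr_Ident HomD(4)[OF f] by auto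
qed

lemma iso_arr_Comp:
  assumes "g \<in> Hom C X Y" "f \<in> Hom C Y Z" "iso_arr C g" "iso_arr C f"
  shows "iso_arr C (f \<cdot> g)"
proof -
  obtain g' where g': "g' \<in> Hom C Y X" "g' \<cdot> g = Ident C X" "g \<cdot> g' = Ident C Y"
    using iso_arrE[OF assms(3,1)] by blast
  obtain f' where f': "f' \<in> Hom C Z Y" "f' \<cdot> f = Ident C Y" "f \<cdot> f' = Ident C Z"
    using iso_arrE[OF assms(4,2)] by blast
  have fg: "f \<cdot> g \<in> Hom C X Z" and gf: "g' \<cdot> f' \<in> Hom C Z X"
    using assms g' f' Comp_in_Hom by blast+
  have "(g' \<cdot> f') \<cdot> (f \<cdot> g) = g' \<cdot> ((f' \<cdot> f) \<cdot> g)"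
    using Comp_assoc assms(1,2) f'(1) g'(1) fg by metis
  then have 1: "(g' \<cdot> f') \<cdot> (f \<cdot> g) = Ident C X"
    using f'(2) g'(2) Comp_Ident_left assms(1) by simp
  have "(f \<cdot> g) \<cdot> (g' \<cdot> f') = f \<cdot> ((g \<cdot> g') \<cdot> f')"
    using Comp_assoc assms(1,2) f'(1) g'(1) gf by metis
  then have 2: "(f \<cdot> g) \<cdot> (g' \<cdot> f') = Ident C Z"
    using f' g'(3) Comp_Ident_left by simp
  show ?thesis using iso_arrI[OF fg gf 1 2] .
qed

lemma iso_arr_Ident:
  assumes "X \<in> Obj C"
  shows "iso_arr C (Ident C X)"
proof -
  have i: "Ident C X \<in> Hom C X X" using Ident_in_Hom[OF assms] .
  show ?thesis by (rule iso_arrI[OF i i]) (simp_all add: Comp_Ident_left[OF i])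
qed

lemma isomorphic_refl: "X \<in> Obj C \<Longrightarrow> isomorphic C X X"
  unfolding isomorphic_def using Ident_in_Hom iso_arr_Ident by blast

lemma isomorphicE:
  assumes "isomorphic C X Y"
  obtains f where "f \<in> Hom C X Y" "iso_arr C f"
  using assms by (auto simp: isomorphic_def)

lemma isomorphicI:
  assumes "f \<in> Hom C X Y" "iso_arr C f"
  shows "isomorphic C X Y"
  using assms HomD(4,5)[OF assms(1)] by (auto simp: isomorphic_def)

lemma isomorphic_sym:
  assumes "isomorphic C X Y"
  shows "isomorphic C Y X"
proof -
  obtain f where f: "f \<in> Hom C X Y" "iso_arr C f" using assms by (rule isomorphicE)
  obtain g where g: "g \<in> Hom C Y X" "g \<cdot> f = Ident C X" "f \<cdot> g = Ident C Y"
    using iso_arrE[OF f(2,1)] .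
  show ?thesis using isomorphicI[OF g(1) iso_arrI[OF g(1) f(1) g(3,2)]] .
qed

lemma isomorphic_trans:
  assumes "isomorphic C X Y" "isomorphic C Y Z"
  shows "isomorphic C X Z"
proof -
  obtain f where f: "f \<in> Hom C X Y" "iso_arr C f" using assms(1) by (rule isomorphicE)
  obtain g where g: "g \<in> Hom C Y Z" "iso_arr C g" using assms(2) by (rule isomorphicE)
  show ?thesis using isomorphicI[OF Comp_in_Hom[OF f(1) g(1)] iso_arr_Comp[OF f(1) g(1) f(2) g(2)]] .
qed

lemma iso_class_eqI: "isomorphic C X Y \<Longrightarrow> iso_class C X = iso_class C Y"
  unfolding iso_class_def using isomorphic_sym isomorphic_trans by blast

end

section \<open>Abelian categories\<close>

context preadditive_category
begin

lemma Zero_in_Hom: "X \<in> Obj C \<Longrightarrow> Y \<in> Obj C \<Longrightarrow> Zero C X Y \<in> Hom C X Y"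
  using monoid.one_closed[of "Hom_group C X Y"] Hom_comm_group[of X Y]
  by (simp add: comm_group_def group_def Hom_group_def)

text \<open>A group has no idempotent but its neutral element. By bilinearity both composites with a
  zero morphism are idempotent, which is how they are recognised as zero below.\<close>

lemma Add_idem_imp_Zero:
  assumes "a \<in> Hom C X Y" "a \<oplus> a = a"
  shows "a = Zero C X Y"
proof -
  interpret G: comm_group "Hom_group C X Y" using Hom_comm_group HomD[OF assms(1)] by blast
  show ?thesis using G.l_cancel_one[of a a] assms by (simp add: Hom_group_def)
qed

lemma Zero_Add_Zero: "X \<in> Obj C \<Longrightarrow> Y \<in> Obj C \<Longrightarrow> Zero C X Y \<oplus> Zero C X Y = Zero C X Y"
  using monoid.l_one[of "Hom_group C X Y" "Zero C X Y"] Hom_comm_group[of X Y] Zero_in_Hom[of X Y]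
  by (simp add: comm_group_def group_def Hom_group_def)

lemma Zero_Comp:
  assumes "f \<in> Hom C X Y" "Z \<in> Obj C"
  shows "Zero C Y Z \<cdot> f = Zero C X Z"
proof (rule Add_idem_imp_Zero)
  have z: "Zero C Y Z \<in> Hom C Y Z" using Zero_in_Hom assms HomD(1,4,5) by blast
  show "Zero C Y Z \<cdot> f \<in> Hom C X Z" using z assms Comp_in_Hom by blast
  show "Zero C Y Z \<cdot> f \<oplus> Zero C Y Z \<cdot> f = Zero C Y Z \<cdot> f"
    using Comp_Add_left[OF assms(1) z z] Zero_Add_Zero HomD(5)[OF assms(1)] assms(2) by simp
qed

lemma Comp_Zero:
  assumes "f \<in> Hom C Y Z" "X \<in> Obj C"
  shows "f \<cdot> Zero C X Y = Zero C X Z"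
proof (rule Add_idem_imp_Zero)
  have z: "Zero C X Y \<in> Hom C X Y" using Zero_in_Hom assms HomD(1,4,5) by blast
  show "f \<cdot> Zero C X Y \<in> Hom C X Z" using z assms Comp_in_Hom by blast
  show "f \<cdot> Zero C X Y \<oplus> f \<cdot> Zero C X Y = f \<cdot> Zero C X Y"
    using Comp_Add_right[OF z z assms(1)] Zero_Add_Zero HomD(4)[OF assms(1)] assms(2) by simp
qed

text \<open>Subtraction in the Hom group turns the cancellation of \<open>f\<close> in an equation
  \<open>g \<cdot> f = h \<cdot> f\<close> into a test on a single morphism that kills
  \<open>f\<close>.\<close>

lemma epi_arrI:
  assumes f: "f \<in> Hom C X Y"
    and z: "\<And>Z h. h \<in> Hom C Y Z \<Longrightarrow> h \<cdot> f = Zero C X Z \<Longrightarrow> h = Zero C Y Z"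
  shows "epi_arr C f"
  unfolding epi_arr_def
proof (intro conjI allI ballI impI)
  show "f \<in> Arr C" using f HomD(1,4,5) by blast
  fix Z g h
  assume "g \<in> Hom C (Cod C f) Z" "h \<in> Hom C (Cod C f) Z" and e: "g \<cdot> f = h \<cdot> f"
  then have g: "g \<in> Hom C Y Z" and h: "h \<in> Hom C Y Z" using HomD(3)[OF f] by auto
  interpret G: comm_group "Hom_group C Y Z" using Hom_comm_group HomD[OF g] by blast
  \<comment> \<open>\<open>k\<close> is the negative of \<open>h\<close>, so
    \<open>g \<oplus> k\<close> stands for the difference of \<open>g\<close> and
    \<open>h\<close>.\<close>
  define k where "k = inv\<^bsub>Hom_group C Y Z\<^esub> h"
  have k: "k \<in> Hom C Y Z" using G.inv_closed[of h] h by (simp add: k_def Hom_group_def)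
  have hk: "h \<oplus> k = Zero C Y Z" using G.r_inv[of h] h by (simp add: k_def Hom_group_def)
  have gk: "g \<oplus> k \<in> Hom C Y Z" using G.m_closed[of g k] g k by (simp add: Hom_group_def)
  have "(g \<oplus> k) \<cdot> f = h \<cdot> f \<oplus> k \<cdot> f" using Comp_Add_left[OF f g k] e by simp
  also have "\<dots> = Zero C X Z"
    using Comp_Add_left[OF f h k] hk Zero_Comp[OF f] HomD(5)[OF h] by simp
  finally have "g \<oplus> k = h \<oplus> k" using z[OF gk] hk by simp
  then show "g = h" using G.right_cancel[of k g h] g h k by (simp add: Hom_group_def)
qed

lemma epi_arr_cancel_Zero:
  assumes "epi_arr C f" "f \<in> Hom C X Y" "h \<in> Hom C Y Z" "h \<cdot> f = Zero C X Z"
  shows "h = Zero C Y Z"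
proof -
  have "Zero C Y Z \<in> Hom C Y Z" "Zero C Y Z \<cdot> f = h \<cdot> f"
    using Zero_in_Hom Zero_Comp[OF assms(2)] HomD(4,5)[OF assms(3)] assms(4) by simp_all
  then show ?thesis using assms(1,3) HomD(3)[OF assms(2)] unfolding epi_arr_def by blast
qed

text \<open>Composing with the identity of \<open>Z\<close> changes no morphism into or out of
  \<open>Z\<close>, yet makes it zero.\<close>

lemma zero_objectI:
  assumes "Z \<in> Obj C" "Ident C Z = Zero C Z Z"
  shows "zero_object C Z"
  unfolding zero_object_def
proof (intro conjI ballI)
  show "Z \<in> Obj C" by fact
  fix X assume X: "X \<in> Obj C"
  show "\<exists>!f. f \<in> Hom C X Z"
    using Zero_in_Hom[OF X assms(1)] Comp_Ident_left Zero_Comp assms by metis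
  show "\<exists>!f. f \<in> Hom C Z X"
    using Zero_in_Hom[OF assms(1) X] Comp_Ident_right Comp_Zero assms by metis
qed

lemma zero_object_Hom:
  assumes "zero_object C Z"
  shows "f \<in> Hom C X Z \<Longrightarrow> f = Zero C X Z" "f \<in> Hom C Z X \<Longrightarrow> f = Zero C Z X"
proof -
  have Z: "Z \<in> Obj C" using assms by (simp add: zero_object_def)
  show "f = Zero C X Z" if f: "f \<in> Hom C X Z"
  proof -
    have X: "X \<in> Obj C" using HomD(4)[OF f] .
    then have "\<exists>!f. f \<in> Hom C X Z" using assms by (simp add: zero_object_def)
    then show ?thesis using f Zero_in_Hom[OF X Z] by blast
  qed
  show "f = Zero C Z X" if f: "f \<in> Hom C Z X"
  proof -
    have X: "X \<in> Obj C" using HomD(5)[OF f] .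
    then have "\<exists>!f. f \<in> Hom C Z X" using assms by (simp add: zero_object_def)
    then show ?thesis using f Zero_in_Hom[OF Z X] by blast
  qed
qed

text \<open>All morphisms into \<open>Y\<close> are zero, so \<open>f\<close> does not separate the
  identity of \<open>X\<close> from its zero endomorphism; being mono, it forces them to agree. This
  is the base case for pulling back composition series.\<close>

lemma mono_arr_to_zero_object:
  assumes "zero_object C Y" "f \<in> Hom C X Y" "mono_arr C f"
  shows "zero_object C X \<and> iso_arr C f"
proof -
  have X: "X \<in> Obj C" and Y: "Y \<in> Obj C" using assms(2) HomD(1,4,5) by blast+
  have z: "f \<cdot> a = Zero C X Y" if "a \<in> Hom C X X" for a
    using that assms zero_object_Hom(1) Comp_in_Hom by blast
  have i: "Ident C X = Zero C X X"
    using mono_arr_cancel[OF assms(3,2)] z Ident_in_Hom Zero_in_Hom X by metis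
  have zX: "zero_object C X" using zero_objectI[OF X i] .
  have "iso_arr C f"
  proof (rule iso_arrI[OF assms(2)])
    show "Zero C Y X \<in> Hom C Y X" using Zero_in_Hom X Y by blast
    then show "Zero C Y X \<cdot> f = Ident C X" "f \<cdot> Zero C Y X = Ident C Y"
      using Zero_Comp[OF assms(2) X] Comp_Zero[OF assms(2) Y] i
        zero_object_Hom(1)[OF assms(1) Ident_in_Hom[OF Y]] by simp_all
  qed
  then show ?thesis using zX by blast
qed

section \<open>Kernels and cokernels\<close>

lemma kernel_factor:
  assumes "kernel_of C f k" "h \<in> Hom C W (Dom C f)" "f \<cdot> h = Zero C W (Cod C f)"
  obtains u where "u \<in> Hom C W (Dom C k)" "k \<cdot> u = h"
proof -
  have "\<exists>!u. u \<in> Hom C W (Dom C k) \<and> k \<cdot> u = h" using assms by (simp add: kernel_of_def)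
  then show ?thesis using that by auto
qed

lemma cokernel_factor:
  assumes "cokernel_of C f c" "h \<in> Hom C (Cod C f) W" "h \<cdot> f = Zero C (Dom C f) W"
  obtains u where "u \<in> Hom C (Cod C c) W" "u \<cdot> c = h"
proof -
  have "\<exists>!u. u \<in> Hom C (Cod C c) W \<and> u \<cdot> c = h" using assms by (simp add: cokernel_of_def)
  then show ?thesis using that by auto
qed

lemma kernel_mono:
  assumes "kernel_of C f k"
  shows "mono_arr C k"
  unfolding mono_arr_def
proof (intro conjI allI ballI impI)
  show "k \<in> Arr C" using assms by (simp add: kernel_of_def)
  then have k: "k \<in> Hom C (Dom C k) (Dom C f)" and f: "f \<in> Hom C (Dom C f) (Cod C f)"
    using assms by (auto simp: kernel_of_def Hom_def)
  fix W a b
  assume a: "a \<in> Hom C W (Dom C k)" and b: "b \<in> Hom C W (Dom C k)" and e: "k \<cdot> a = k \<cdot> b"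
  have ka: "k \<cdot> a \<in> Hom C W (Dom C f)" using a k Comp_in_Hom by blast
  have "f \<cdot> (k \<cdot> a) = Zero C W (Cod C f)"
    using Comp_assoc[OF a k f] assms Zero_Comp[OF a] HomD(5)[OF f] by (simp add: kernel_of_def)
  then have "\<exists>!u. u \<in> Hom C W (Dom C k) \<and> k \<cdot> u = k \<cdot> a"
    using assms ka unfolding kernel_of_def by blast
  then show "a = b" using a b e by metis
qed

lemma cokernel_epi:
  assumes "cokernel_of C f c"
  shows "epi_arr C c"
  unfolding epi_arr_def
proof (intro conjI allI ballI impI)
  show "c \<in> Arr C" using assms by (simp add: cokernel_of_def)
  then have c: "c \<in> Hom C (Cod C f) (Cod C c)" and f: "f \<in> Hom C (Dom C f) (Cod C f)"
    using assms by (auto simp: cokernel_of_def Hom_def)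
  fix W a b
  assume a: "a \<in> Hom C (Cod C c) W" and b: "b \<in> Hom C (Cod C c) W" and e: "a \<cdot> c = b \<cdot> c"
  have ac: "a \<cdot> c \<in> Hom C (Cod C f) W" using a c Comp_in_Hom by blast
  have "(a \<cdot> c) \<cdot> f = Zero C (Dom C f) W"
    using Comp_assoc[OF f c a] assms Comp_Zero[OF a] HomD(4)[OF f] by (simp add: cokernel_of_def)
  then have "\<exists>!u. u \<in> Hom C (Cod C c) W \<and> u \<cdot> c = a \<cdot> c"
    using assms ac unfolding cokernel_of_def by blast
  then show "a = b" using a b e by metis
qed

end

context abelian_category
begin

text \<open>\<open>f\<close> is the kernel of some \<open>h\<close>, and \<open>h\<close> factors
  through the cokernel \<open>c\<close> because it kills \<open>f\<close>. Whatever \<open>c\<close>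
  kills is then killed by \<open>h\<close> and so factors uniquely through \<open>f\<close>.\<close>

lemma mono_is_kernel_of_cokernel:
  assumes f: "mono_arr C f" and c: "cokernel_of C f c"
  shows "kernel_of C c f"
proof -
  have cc: "c \<in> Hom C (Cod C f) (Cod C c)" and ff: "f \<in> Hom C (Dom C f) (Cod C f)"
    using c by (auto simp: cokernel_of_def Hom_def)
  obtain h where h: "kernel_of C h f" using mono_is_kernel f by blast
  then have hh: "h \<in> Hom C (Cod C f) (Cod C h)" and hf: "h \<cdot> f = Zero C (Dom C f) (Cod C h)"
    and D: "Dom C h = Cod C f"
    by (auto simp: kernel_of_def Hom_def)
  obtain u where u: "u \<in> Hom C (Cod C c) (Cod C h)" "u \<cdot> c = h"
    using cokernel_factor[OF c hh hf] by blast
  show ?thesis unfolding kernel_of_def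
  proof (intro conjI allI ballI impI)
    show "c \<in> Arr C" "f \<in> Arr C" "Cod C f = Dom C c" "c \<cdot> f = Zero C (Dom C f) (Cod C c)"
      using c by (auto simp: cokernel_of_def)
    fix W a
    assume "a \<in> Hom C W (Dom C c)" and z: "c \<cdot> a = Zero C W (Cod C c)"
    then have a: "a \<in> Hom C W (Cod C f)" using HomD(2)[OF cc] by simp
    have "h \<cdot> a = Zero C W (Cod C h)"
      using Comp_assoc[OF a cc u(1)] z u(2) Comp_Zero[OF u(1)] HomD(4)[OF a] by simp
    then show "\<exists>!v. v \<in> Hom C W (Dom C f) \<and> f \<cdot> v = a"
      using h a D unfolding kernel_of_def by simp
  qed
qed

text \<open>Dually, \<open>f\<close> is the cokernel of some \<open>h\<close>, and \<open>h\<close>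
  factors through the kernel \<open>k\<close>. Whatever kills \<open>k\<close> then kills
  \<open>h\<close> and so factors uniquely through \<open>f\<close>.\<close>

lemma epi_is_cokernel_of_kernel:
  assumes f: "epi_arr C f" and k: "kernel_of C f k"
  shows "cokernel_of C k f"
proof -
  have kk: "k \<in> Hom C (Dom C k) (Dom C f)" and ff: "f \<in> Hom C (Dom C f) (Cod C f)"
    using k by (auto simp: kernel_of_def Hom_def)
  obtain h where h: "cokernel_of C h f" using epi_is_cokernel f by blast
  then have hh: "h \<in> Hom C (Dom C h) (Dom C f)" and hf: "f \<cdot> h = Zero C (Dom C h) (Cod C f)"
    and D: "Cod C h = Dom C f"
    by (auto simp: cokernel_of_def Hom_def)
  obtain u where u: "u \<in> Hom C (Dom C h) (Dom C k)" "k \<cdot> u = h"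
    using kernel_factor[OF k hh hf] by blast
  show ?thesis unfolding cokernel_of_def
  proof (intro conjI allI ballI impI)
    show "k \<in> Arr C" "f \<in> Arr C" "Dom C f = Cod C k" "f \<cdot> k = Zero C (Dom C k) (Cod C f)"
      using k by (auto simp: kernel_of_def)
    fix W a
    assume "a \<in> Hom C (Cod C k) W" and z: "a \<cdot> k = Zero C (Dom C k) W"
    then have a: "a \<in> Hom C (Dom C f) W" using HomD(3)[OF kk] by simp
    have "a \<cdot> h = Zero C (Dom C h) W"
      using Comp_assoc[OF u(1) kk a] z u(2) Zero_Comp[OF u(1)] HomD(5)[OF a] by simp
    then show "\<exists>!v. v \<in> Hom C (Cod C f) W \<and> v \<cdot> f = a"
      using h a D unfolding cokernel_of_def by simp
  qed
qed

text \<open>\<open>f\<close> is the kernel of some \<open>h\<close>, and \<open>h\<close> is zero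
  because \<open>f\<close> is epi. Hence the identity of \<open>Y\<close> factors through
  \<open>f\<close>, which gives a right inverse; since \<open>f\<close> is mono, it is also a left
  inverse.\<close>

lemma mono_epi_imp_iso:
  assumes f: "f \<in> Hom C X Y" and m: "mono_arr C f" and e: "epi_arr C f"
  shows "iso_arr C f"
proof -
  note F = HomD[OF f]
  obtain h where h: "kernel_of C h f" using mono_is_kernel m by blast
  then have hh: "h \<in> Hom C Y (Cod C h)" and D: "Dom C h = Y"
    and hf: "h \<cdot> f = Zero C X (Cod C h)"
    using F by (auto simp: kernel_of_def Hom_def)
  have h0: "h = Zero C Y (Cod C h)" using epi_arr_cancel_Zero[OF e f hh hf] .
  have i: "Ident C Y \<in> Hom C Y Y" using Ident_in_Hom F by blast
  then obtain u where u: "u \<in> Hom C Y X" "f \<cdot> u = Ident C Y"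
    using kernel_factor[OF h, of "Ident C Y" Y] D F h0 Zero_Comp[OF i HomD(5)[OF hh]] by auto
  have "f \<cdot> (u \<cdot> f) = f \<cdot> Ident C X"
    using Comp_assoc[OF f u(1) f] u(2) Comp_Ident_left[OF f] Comp_Ident_right[OF f] by simp
  then have "u \<cdot> f = Ident C X"
    using mono_arr_cancel[OF m f] u f Comp_in_Hom Ident_in_Hom F by blast
  then show ?thesis using iso_arrI f u by blast
qed

text \<open>The image of \<open>a\<close> is a nonzero subobject of \<open>S\<close>, hence all of
  \<open>S\<close>. So the cokernel \<open>c\<close> of \<open>a\<close> is zero, and every morphism
  that kills \<open>a\<close> factors through \<open>c\<close>.\<close>

lemma nonzero_to_simple_epi:
  assumes S: "simple_object C S" and a: "a \<in> Hom C X S" and n: "a \<noteq> Zero C X S"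
  shows "epi_arr C a"
proof -
  note A = HomD[OF a]
  obtain c where c: "cokernel_of C a c" using cokernel_exists A by blast
  then have cc: "c \<in> Hom C S (Cod C c)" and ca: "c \<cdot> a = Zero C X (Cod C c)"
    using A by (auto simp: cokernel_of_def Hom_def)
  \<comment> \<open>The kernel of the cokernel is the image of \<open>a\<close>.\<close>
  obtain k where k: "kernel_of C c k" using kernel_exists HomD[OF cc] by blast
  then have kk: "k \<in> Hom C (Dom C k) S" and ck: "c \<cdot> k = Zero C (Dom C k) (Cod C c)"
    using HomD[OF cc] by (auto simp: kernel_of_def Hom_def)
  obtain e where e: "e \<in> Hom C X (Dom C k)" "k \<cdot> e = a"
    using kernel_factor[OF k, of a X] a ca HomD[OF cc] by auto
  have "zero_object C (Dom C k) \<or> iso_arr C k"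
    using S kk kernel_mono[OF k] unfolding simple_object_def by blast
  moreover have "\<not> zero_object C (Dom C k)"
  proof
    assume "zero_object C (Dom C k)"
    then have "e = Zero C X (Dom C k)" using zero_object_Hom(1) e by blast
    then show False using e n Comp_Zero[OF kk] A by simp
  qed
  ultimately have "iso_arr C k" by blast
  then obtain k' where k': "k' \<in> Hom C S (Dom C k)" "k \<cdot> k' = Ident C S"
    using iso_arrE[OF _ kk] by blast
  have c0: "c = Zero C S (Cod C c)"
    using Comp_assoc[OF k'(1) kk cc] k'(2) ck Zero_Comp[OF k'(1) HomD(5)[OF cc]]
      Comp_Ident_right[OF cc] by simp
  show ?thesis
  proof (rule epi_arrI[OF a])
    fix Z h assume h: "h \<in> Hom C S Z" "h \<cdot> a = Zero C X Z"
    obtain u where u: "u \<in> Hom C (Cod C c) Z" "u \<cdot> c = h"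
      using cokernel_factor[OF c, of h Z] h A by auto
    have "h = u \<cdot> Zero C S (Cod C c)" using u(2)[symmetric] arg_cong[OF c0, of "\<lambda>a. u \<cdot> a"]
      by (rule trans)
    then show "h = Zero C S Z" using Comp_Zero[OF u(1) HomD(4)[OF cc]] by simp
  qed
qed

text \<open>If \<open>f\<close> were an isomorphism, \<open>c\<close> would be zero; as
  \<open>c\<close> is epi, the identity of its simple codomain would then be zero too.\<close>

lemma cokernel_simple_not_iso:
  assumes f: "f \<in> Hom C X Y" and c: "cokernel_of C f c" and S: "simple_object C (Cod C c)"
  shows "\<not> iso_arr C f"
proof
  assume "iso_arr C f"
  then obtain g where g: "g \<in> Hom C Y X" "f \<cdot> g = Ident C Y" using iso_arrE f by blast
  note F = HomD[OF f]
  let ?S = "Cod C c"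
  have cc: "c \<in> Hom C Y ?S" and cf: "c \<cdot> f = Zero C X ?S"
    using c F by (auto simp: cokernel_of_def Hom_def)
  have c0: "c = Zero C Y ?S"
    using Comp_assoc[OF g(1) f cc] g(2) cf Zero_Comp[OF g(1) HomD(5)[OF cc]]
      Comp_Ident_right[OF cc] by simp
  have i: "Ident C ?S \<in> Hom C ?S ?S" using Ident_in_Hom HomD[OF cc] by blast
  have "Ident C ?S \<cdot> c = Zero C Y ?S" using Comp_Ident_left[OF cc] c0 by (rule trans)
  then have "Ident C ?S = Zero C ?S ?S"
    using epi_arr_cancel_Zero[OF cokernel_epi[OF c] cc i] by blast
  then show False using S zero_objectI HomD(5)[OF cc] by (simp add: simple_object_def)
qed

end

section \<open>Length\<close>

context abelian_category
begin

text \<open>The composition series of \<open>Y\<close> is pulled back along \<open>g\<close>: the last step \<open>X \<rightarrow> Y \<rightarrow> S\<close>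
  gives the kernel \<open>P\<close> of \<open>Z \<rightarrow> Y \<rightarrow> S\<close>, and the composite \<open>Z \<rightarrow> S\<close> is zero or epi.\<close>

lemma composition_series_mono:
  assumes "has_composition_series C Y n" "g \<in> Hom C Z Y" "mono_arr C g"
  shows "\<exists>m \<le> n. has_composition_series C Z m \<and> (\<not> iso_arr C g \<longrightarrow> m < n)"
  using assms
proof (induction arbitrary: Z g rule: has_composition_series.induct)
  case (zero Y)
  then have "zero_object C Z \<and> iso_arr C g" using mono_arr_to_zero_object by blast
  then show ?case by (intro exI[of _ 0]) (simp add: has_composition_series.zero)
next
  case (step X n f Y c)
  note f = step.hyps(2) and c = step.hyps(4) and g = step.prems(1)
  let ?S = "Cod C c"
  have kf: "kernel_of C c f" using mono_is_kernel_of_cokernel[OF step.hyps(3,4)] .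
  have cc: "c \<in> Hom C Y ?S" and cf: "c \<cdot> f = Zero C X ?S"
    using c HomD[OF f] by (auto simp: cokernel_of_def Hom_def)
  have cg: "c \<cdot> g \<in> Hom C Z ?S" using Comp_in_Hom[OF g cc] .
  show ?case
  proof (cases "c \<cdot> g = Zero C Z ?S")
    \<comment> \<open>Here \<open>Z\<close> already embeds into \<open>X\<close>, so its length is
      at most \<open>n\<close>. This is below \<open>Suc n\<close>, as strictness asks.\<close>
    case True
    then obtain u where u: "u \<in> Hom C Z X" "f \<cdot> u = g"
      using kernel_factor[OF kf, of g Z] g HomD[OF cc] HomD[OF f] by auto
    then have "mono_arr C u" using mono_arr_right_factor[OF u(1) f] step.prems by simp
    then obtain m where "m \<le> n" "has_composition_series C Z m" using step.IH[OF u(1)] by blast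
    then show ?thesis by (intro exI[of _ m]) simp
  next
    case False
    then have e: "epi_arr C (c \<cdot> g)" using nonzero_to_simple_epi[OF step.hyps(5) cg] by blast
    obtain k where k: "kernel_of C (c \<cdot> g) k" using kernel_exists HomD[OF cg] by blast
    let ?P = "Dom C k"
    have kk: "k \<in> Hom C ?P Z" and ck: "(c \<cdot> g) \<cdot> k = Zero C ?P ?S"
      using k HomD[OF cg] by (auto simp: kernel_of_def Hom_def)
    have gk: "g \<cdot> k \<in> Hom C ?P Y" using Comp_in_Hom[OF kk g] .
    have "c \<cdot> (g \<cdot> k) = Zero C ?P ?S" using Comp_assoc[OF kk g cc] ck by simp
    then obtain u where u: "u \<in> Hom C ?P X" "f \<cdot> u = g \<cdot> k"
      using kernel_factor[OF kf, of "g \<cdot> k" ?P] gk HomD[OF cc] HomD[OF f] by auto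
    have "mono_arr C u"
      using mono_arr_right_factor[OF u(1) f] mono_arr_Comp[OF kk g kernel_mono[OF k] step.prems(2)]
        u(2) by simp
    then obtain m where m: "m \<le> n" "has_composition_series C ?P m" "\<not> iso_arr C u \<longrightarrow> m < n"
      using step.IH[OF u(1)] by blast
    \<comment> \<open>The quotient of \<open>Z\<close> by \<open>P\<close> is again
      \<open>S\<close>, so a series of \<open>P\<close> extends by one step to
      \<open>Z\<close>.\<close>
    have "cokernel_of C k (c \<cdot> g)" using epi_is_cokernel_of_kernel[OF e k] .
    then have "has_composition_series C Z (Suc m)"
      using has_composition_series.step[OF m(2) kk kernel_mono[OF k]] step.hyps(5) HomD[OF cg]
      by simp
    \<comment> \<open>Strictness for \<open>g\<close> is inherited from \<open>u\<close> by
      contraposition. If \<open>u\<close> is an isomorphism, then \<open>f\<close> factors through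
      \<open>g\<close>. A morphism \<open>h\<close> that kills \<open>g\<close> thus kills
      \<open>f\<close>, so \<open>h = w \<cdot> c\<close>, and \<open>w\<close> vanishes because it
      kills the epi \<open>c \<cdot> g\<close>.\<close>
    moreover have "iso_arr C g" if iu: "iso_arr C u"
    proof (rule mono_epi_imp_iso[OF g step.prems(2) epi_arrI[OF g]])
      obtain v where v: "v \<in> Hom C X ?P" "u \<cdot> v = Ident C X" using iso_arrE[OF iu u(1)] by blast
      have "(f \<cdot> u) \<cdot> v = f"
        using Comp_assoc[OF v(1) u(1) f] v(2) Comp_Ident_right[OF f] by simp
      then have fgk: "g \<cdot> (k \<cdot> v) = f" using u(2) Comp_assoc[OF v(1) kk g] by simp
      have kv: "k \<cdot> v \<in> Hom C X Z" using Comp_in_Hom[OF v(1) kk] .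
      fix W h assume h: "h \<in> Hom C Y W" and hg: "h \<cdot> g = Zero C Z W"
      have "h \<cdot> f = Zero C X W"
        using Comp_assoc[OF kv g h] fgk hg Zero_Comp[OF kv] HomD(5)[OF h] by simp
      then obtain w where w: "w \<in> Hom C ?S W" "w \<cdot> c = h"
        using cokernel_factor[OF c, of h W] h HomD[OF f] by auto
      have "w \<cdot> (c \<cdot> g) = Zero C Z W" using Comp_assoc[OF g cc w(1)] w(2) hg by simp
      then have "w = Zero C ?S W" using epi_arr_cancel_Zero[OF e cg w(1)] by blast
      then show "h = Zero C Y W" using w(2) Zero_Comp[OF cc] HomD(5)[OF h] by simp
    qed
    ultimately show ?thesis using m by (intro exI[of _ "Suc m"]) auto
  qed
qed

text \<open>The last step \<open>X \<rightarrow> Y\<close> of the first series is not an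
  isomorphism, so pulling the second series back to \<open>X\<close> shortens it. Induction along
  the first series compares the rest.\<close>

lemma composition_series_le:
  "has_composition_series C Y n \<Longrightarrow> has_composition_series C Y n' \<Longrightarrow> n \<le> n'"
proof (induction arbitrary: n' rule: has_composition_series.induct)
  case (step X n f Y c)
  then obtain m where "m < n'" "has_composition_series C X m"
    using composition_series_mono[OF step.prems step.hyps(2,3)]
      cokernel_simple_not_iso[OF step.hyps(2,4,5)] by blast
  then show ?case using step.IH by fastforce
qed simp

lemma obj_length_eq:
  assumes "has_composition_series C X n"
  shows "obj_length C X = n"
  unfolding obj_length_def
proof (rule the_equality)
  show "has_composition_series C X n" by fact
  show "m = n" if "has_composition_series C X m" for m
    using composition_series_le[OF assms that] composition_series_le[OF that assms] by simp
qed

end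

context abelian_length_category
begin

lemma has_composition_series_obj_length:
  "X \<in> Obj C \<Longrightarrow> has_composition_series C X (obj_length C X)"
  using finite_length obj_length_eq by metis

lemma obj_length_mono:
  assumes "f \<in> Hom C X Y" "mono_arr C f"
  shows "obj_length C X \<le> obj_length C Y"
    "\<not> iso_arr C f \<Longrightarrow> obj_length C X < obj_length C Y"
  using composition_series_mono[OF has_composition_series_obj_length assms] HomD[OF assms(1)]
    obj_length_eq by blast+

lemma obj_length_isomorphic:
  assumes "isomorphic C X Y"
  shows "obj_length C X = obj_length C Y"
proof -
  have "obj_length C X \<le> obj_length C Y" if "isomorphic C X Y" for X Y
    using isomorphicE[OF that] obj_length_mono(1) iso_arr_imp_mono_arr by metis
  then show ?thesis using assms isomorphic_sym antisym by metis
qed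

lemma obj_length_pos:
  assumes "X \<in> Obj C" "\<not> zero_object C X"
  shows "0 < obj_length C X"
proof (rule ccontr)
  assume "\<not> ?thesis"
  then have "has_composition_series C X 0"
    using has_composition_series_obj_length[OF assms(1)] by simp
  then show False using assms(2) by (cases rule: has_composition_series.cases) auto
qed

section \<open>Length of isomorphism classes\<close>

lemma ind_iso_class:
  assumes "X \<in> ind C" "x \<in> X"
  shows "X = iso_class C x"
  using assms iso_class_eqI by (auto simp: ind_def iso_class_def)

text \<open>Isomorphic objects have equal length, so any representative gives the same value as the
  one chosen by \<open>SOME\<close>.\<close>

lemma cls_length_eq:
  assumes "X \<in> ind C" "x \<in> X"
  shows "cls_length C X = obj_length C x"
proof -
  have "(SOME x. x \<in> X) \<in> X" using assms(2) by (rule someI)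
  then show ?thesis
    using ind_iso_class[OF assms] obj_length_isomorphic
    by (metis cls_length_def iso_class_def mem_Collect_eq)
qed

lemma cls_length_pos:
  assumes "X \<in> ind C"
  shows "0 < cls_length C X"
proof -
  obtain x where x: "indecomposable C x" "X = iso_class C x" using assms by (auto simp: ind_def)
  then have "x \<in> X" using isomorphic_refl by (auto simp: iso_class_def indecomposable_def)
  then show ?thesis
    using cls_length_eq[OF assms] obj_length_pos x(1) by (simp add: indecomposable_def)
qed

text \<open>An isomorphism between representatives would make the two classes equal, so the
  monomorphism is proper. This is what the later inductions on length rest on.\<close>

lemma cls_length_less:
  assumes "X \<in> ind C" "Y \<in> ind C" "cls_ssub C X Y"
  shows "cls_length C X < cls_length C Y"
proof -
  obtain x y f where f: "x \<in> X" "y \<in> Y" "f \<in> Hom C x y" "mono_arr C f" and ne: "X \<noteq> Y"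
    using assms(3) unfolding cls_ssub_def cls_sub_def by blast
  have "\<not> iso_arr C f"
  proof
    assume "iso_arr C f"
    then have "isomorphic C x y" using isomorphicI[OF f(3)] by blast
    then show False
      using iso_class_eqI ind_iso_class[OF assms(1) f(1)] ind_iso_class[OF assms(2) f(2)] ne
      by simp
  qed
  then show ?thesis
    using obj_length_mono(2)[OF f(3,4)] cls_length_eq[OF assms(1) f(1)]
      cls_length_eq[OF assms(2) f(2)] by simp
qed

end

section \<open>The lexicographic order\<close>

text \<open>The strict part of \<open>lex_le\<close>, with the infima replaced by a witness: the
  first place where the sets differ, which has to lie in the larger set.\<close>

definition lex_less :: "nat set \<Rightarrow> nat set \<Rightarrow> bool" where
  "lex_less A B \<longleftrightarrow> (\<exists>n \<in> B - A. \<forall>m < n. m \<in> A \<longleftrightarrow> m \<in> B)"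

lemma lex_lessI: "n \<in> B \<Longrightarrow> n \<notin> A \<Longrightarrow> (\<And>m. m < n \<Longrightarrow> m \<in> A \<longleftrightarrow> m \<in> B) \<Longrightarrow> lex_less A B"
  unfolding lex_less_def by blast

lemma lex_lessE:
  assumes "lex_less A B"
  obtains n where "n \<in> B" "n \<notin> A" "\<And>m. m < n \<Longrightarrow> m \<in> A \<longleftrightarrow> m \<in> B"
  using assms unfolding lex_less_def by blast

lemma lex_less_linear: "A = B \<or> lex_less A B \<or> lex_less B A"
proof (cases "A = B")
  case False
  then have "\<exists>n. (n \<in> A) \<noteq> (n \<in> B)" by blast
  then obtain n where "(n \<in> A) \<noteq> (n \<in> B)" "\<forall>m < n. (m \<in> A) = (m \<in> B)"
    using exists_least_iff[of "\<lambda>n. (n \<in> A) \<noteq> (n \<in> B)"] by blast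
  then show ?thesis unfolding lex_less_def by blast
qed simp

text \<open>The smaller of the two places of first difference is the place where \<open>A\<close>
  and \<open>D\<close> first differ.\<close>

lemma lex_less_trans: "lex_less A B \<Longrightarrow> lex_less B D \<Longrightarrow> lex_less A D"
proof (elim lex_lessE)
  fix m n
  assume m: "m \<in> B" "m \<notin> A" "\<And>i. i < m \<Longrightarrow> i \<in> A \<longleftrightarrow> i \<in> B"
    and n: "n \<in> D" "n \<notin> B" "\<And>i. i < n \<Longrightarrow> i \<in> B \<longleftrightarrow> i \<in> D"
  then have "m \<noteq> n" by blast
  then consider "m < n" | "n < m" by linarith
  then show "lex_less A D"
  proof cases
    case 1
    then show ?thesis using m n(3) by (intro lex_lessI[of m]) auto
  next
    case 2
    then show ?thesis using n m(3) by (intro lex_lessI[of n]) auto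
  qed
qed

lemma lex_less_imp_lex_le:
  assumes "lex_less A B"
  shows "lex_le A B"
proof -
  obtain n where n: "n \<in> B" "n \<notin> A" "\<And>m. m < n \<Longrightarrow> m \<in> A \<longleftrightarrow> m \<in> B"
    using assms unfolding lex_less_def by blast
  have "(INF n \<in> B - A. enat n) \<le> enat n" using n by (intro INF_lower) auto
  also have "\<dots> \<le> (INF n \<in> A - B. enat n)"
  proof (rule INF_greatest)
    fix m assume "m \<in> A - B"
    then have "\<not> m < n" using n(3) by blast
    then show "enat n \<le> enat m" by simp
  qed
  finally show ?thesis by (simp add: lex_le_def)
qed

lemma lex_less_imp_not_lex_le:
  assumes "lex_less A B"
  shows "\<not> lex_le B A"
proof -
  obtain n where n: "n \<in> B" "n \<notin> A" "\<And>m. m < n \<Longrightarrow> m \<in> A \<longleftrightarrow> m \<in> B"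
    using assms unfolding lex_less_def by blast
  \<comment> \<open>The bound also covers an empty \<open>A - B\<close>, whose infimum is
    infinite.\<close>
  have "enat (Suc n) \<le> (INF n \<in> A - B. enat n)"
  proof (rule INF_greatest)
    fix m assume m: "m \<in> A - B"
    then have "\<not> m < n" "m \<noteq> n" using n by blast+
    then show "enat (Suc n) \<le> enat m" by simp
  qed
  then have "enat n < (INF n \<in> A - B. enat n)" by (rule less_le_trans[rotated]) simp
  moreover have "(INF n \<in> B - A. enat n) \<le> enat n" using n by (intro INF_lower) auto
  ultimately have "(INF n \<in> B - A. enat n) < (INF n \<in> A - B. enat n)"
    by (rule le_less_trans[rotated])
  then show ?thesis by (simp add: lex_le_def)
qed

lemma lex_le_iff: "lex_le A B \<longleftrightarrow> A = B \<or> lex_less A B"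
proof -
  have "lex_le A A" by (simp add: lex_le_def)
  then show ?thesis
    using lex_less_linear[of A B] lex_less_imp_lex_le[of A B] lex_less_imp_not_lex_le[of B A] by blast
qed

lemma not_lex_le: "\<not> lex_le A B \<longleftrightarrow> lex_less B A"
  using lex_less_linear[of A B] lex_le_iff[of A B] lex_less_imp_not_lex_le[of B A] by blast

lemma lex_le_antisym: "lex_le A B \<Longrightarrow> lex_le B A \<Longrightarrow> A = B"
  using lex_le_iff[of A B] not_lex_le[of B A] by blast

lemma lex_le_trans: "lex_le A B \<Longrightarrow> lex_le B D \<Longrightarrow> lex_le A D"
  using lex_less_trans by (auto simp: lex_le_iff)

lemma lex_less_le_trans: "lex_less A B \<Longrightarrow> lex_le B D \<Longrightarrow> lex_less A D"
  using lex_less_trans by (auto simp: lex_le_iff)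

text \<open>The infimum over the empty set \<open>A - B\<close> is the top element.\<close>

lemma subset_imp_lex_le: "A \<subseteq> B \<Longrightarrow> lex_le A B"
  by (simp add: lex_le_def Diff_eq_empty_iff[THEN iffD2] top_enat_def)

lemma lex_le_empty_iff: "lex_le A {} \<longleftrightarrow> A = {}"
  by (auto simp: lex_le_iff lex_less_def)

lemma finite_lex_max:
  assumes "finite S" "S \<noteq> {}"
  shows "\<exists>M \<in> S. \<forall>N \<in> S. lex_le N M"
  using assms
proof (induction rule: finite_ne_induct)
  case (singleton A)
  then show ?case by (simp add: lex_le_iff)
next
  case (insert A S)
  then obtain M where M: "M \<in> S" "\<forall>N \<in> S. lex_le N M" by blast
  show ?case
  proof (cases "lex_le A M")
    case True
    then show ?thesis using M by blast
  next
    case False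
    then have "lex_le M A" by (simp add: not_lex_le lex_less_imp_lex_le)
    then have "\<forall>N \<in> insert A S. lex_le N A"
      using M(2) lex_le_trans[OF _ \<open>lex_le M A\<close>] by (simp add: lex_le_iff[of A A])
    then show ?thesis by blast
  qed
qed

text \<open>A first difference lies in \<open>B\<close>, hence below \<open>n\<close>, and is not
  affected by adding \<open>n\<close> to both sets.\<close>

lemma lex_le_insert_mono:
  assumes "lex_le A B" "\<forall>b \<in> B. b < n"
  shows "lex_le (insert n A) (insert n B)"
proof (cases "A = B")
  case False
  then have "lex_less A B" using assms by (simp add: lex_le_iff)
  then obtain m where m: "m \<in> B" "m \<notin> A" "\<And>i. i < m \<Longrightarrow> i \<in> A \<longleftrightarrow> i \<in> B" unfolding lex_less_def by blast
  then have "lex_less (insert n A) (insert n B)"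
    using assms(2) by (intro lex_lessI[of m]) auto
  then show ?thesis by (rule lex_less_imp_lex_le)
qed (simp add: lex_le_iff)

text \<open>The combinatorial core of (GR3). If the first difference is \<open>n\<close> itself,
  adding \<open>n\<close> to \<open>A\<close> yields exactly \<open>B\<close>; otherwise it lies
  below \<open>n\<close> and persists.\<close>

lemma lex_less_imp_insert_le:
  assumes "lex_less A B" "\<forall>a \<in> A. a < n" "\<forall>b \<in> B. b \<le> n"
  shows "lex_le (insert n A) B"
proof -
  obtain m where m: "m \<in> B" "m \<notin> A" "\<And>i. i < m \<Longrightarrow> i \<in> A \<longleftrightarrow> i \<in> B"
    using assms(1) unfolding lex_less_def by blast
  show ?thesis
  proof (cases "m = n")
    case True
    have "i \<in> insert n A \<longleftrightarrow> i \<in> B" for i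
      using m assms(2,3) True by (cases i n rule: linorder_cases) auto
    then show ?thesis by (auto simp: lex_le_iff)
  next
    case False
    then have "m < n" using m(1) assms(3) le_neq_implies_less by blast
    then have "lex_less (insert n A) B" using m by (intro lex_lessI[of m]) auto
    then show ?thesis by (rule lex_less_imp_lex_le)
  qed
qed

text \<open>A first difference at \<open>n\<close> means that \<open>A\<close> and \<open>B\<close>
  agree below \<open>n\<close> and have nothing beyond, so they are equal. Any other first
  difference lies in \<open>B\<close>, below \<open>n\<close>. In the uniqueness proof this gives
  the comparison of lengths.\<close>

lemma lex_less_insertD:
  assumes "lex_less A (insert n B)" "\<forall>a \<in> A. a \<le> n" "\<forall>b \<in> B. b < n"
  shows "lex_le A B"
proof -
  obtain m where m: "m \<in> insert n B" "m \<notin> A" "\<And>i. i < m \<Longrightarrow> i \<in> A \<longleftrightarrow> i \<in> insert n B"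
    using assms(1) unfolding lex_less_def by blast
  show ?thesis
  proof (cases "m = n")
    case True
    have "i \<in> A \<longleftrightarrow> i \<in> B" for i
      using m assms(2,3) True by (cases i n rule: linorder_cases) auto
    then show ?thesis by (auto simp: lex_le_iff)
  next
    case False
    then have "m \<in> B" using m by simp
    then have "m < n" using assms(3) by simp
    then have "lex_less A B" using m \<open>m \<in> B\<close> by (intro lex_lessI[of m]) auto
    then show ?thesis by (rule lex_less_imp_lex_le)
  qed
qed

section \<open>The Gabriel-Roiter measure\<close>

context abelian_length_category
begin

section \<open>Chains of indecomposables and their sets of lengths\<close>

lemma ind_chain_iff:
  "ind_chain C Xs X \<longleftrightarrow> X \<in> ind C \<and>
    (Xs = [X] \<or> (\<exists>Ys Y. Xs = Ys @ [X] \<and> ind_chain C Ys Y \<and> cls_ssub C Y X))"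
proof (cases Xs rule: rev_cases)
  case (snoc Ys Z)
  then show ?thesis
    by (cases "Ys = []") (auto simp: ind_chain_def successively_append_iff)
qed (simp add: ind_chain_def)

text \<open>A chain ending in \<open>X\<close> either is \<open>X\<close> alone or extends a chain
  that ends in a proper subobject, so the sets of lengths obey a recursion.\<close>

lemma chain_lengths_rec:
  assumes X: "X \<in> ind C"
  shows "A \<in> chain_lengths C X \<longleftrightarrow> A = {cls_length C X} \<or>
    (\<exists>Y \<in> ind C. \<exists>B \<in> chain_lengths C Y. cls_ssub C Y X \<and> A = insert (cls_length C X) B)"
    (is "?L \<longleftrightarrow> ?R")
proof
  assume ?L
  then obtain Xs where Xs: "ind_chain C Xs X" and A: "A = cls_length C ` set Xs"
    by (auto simp: chain_lengths_def)
  consider "Xs = [X]" | Ys Y where "Xs = Ys @ [X]" "ind_chain C Ys Y" "cls_ssub C Y X"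
    using Xs ind_chain_iff[of Xs X] by blast
  then show ?R
  proof cases
    case 2
    then have "Y \<in> ind C" using ind_chain_iff[of Ys Y] by blast
    moreover have "cls_length C ` set Ys \<in> chain_lengths C Y"
      using 2(2) by (auto simp: chain_lengths_def)
    moreover have "A = insert (cls_length C X) (cls_length C ` set Ys)" using A 2(1) by simp
    ultimately show ?thesis using 2(3) by blast
  qed (simp add: A)
next
  assume ?R
  then consider "A = {cls_length C X}"
    | Y B where "B \<in> chain_lengths C Y" "cls_ssub C Y X" "A = insert (cls_length C X) B" by blast
  then show ?L
  proof cases
    case 1
    have "ind_chain C [X] X" using X by (simp add: ind_chain_def)
    then show ?thesis using 1 by (force simp: chain_lengths_def)
  next
    case 2
    then obtain Ys where Ys: "ind_chain C Ys Y" "B = cls_length C ` set Ys"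
      by (auto simp: chain_lengths_def)
    then have "ind_chain C (Ys @ [X]) X" using X 2(2) ind_chain_iff[of "Ys @ [X]" X] by blast
    moreover have "A = cls_length C ` set (Ys @ [X])" using 2(3) Ys(2) by simp
    ultimately show ?thesis unfolding chain_lengths_def by blast
  qed
qed

lemma chain_lengths_bounds:
  assumes "X \<in> ind C" "A \<in> chain_lengths C X"
  shows "cls_length C X \<in> A" "A \<subseteq> {1..cls_length C X}"
proof -
  have "cls_length C X \<in> A \<and> A \<subseteq> {1..cls_length C X}"
    using assms
  proof (induction "cls_length C X" arbitrary: X A rule: less_induct)
    case less
    have p: "1 \<le> cls_length C X" using cls_length_pos[OF less.prems(1)] by simp
    consider "A = {cls_length C X}"
      | Y B where "Y \<in> ind C" "B \<in> chain_lengths C Y" "cls_ssub C Y X"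
          "A = insert (cls_length C X) B"
      using chain_lengths_rec[OF less.prems(1)] less.prems(2) by blast
    then show ?case
    proof cases
      case 2
      have "cls_length C Y < cls_length C X"
        using cls_length_less[OF 2(1) less.prems(1) 2(3)] .
      then show ?thesis using less.hyps[of Y B] 2 p by fastforce
    qed (use p in simp)
  qed
  then show "cls_length C X \<in> A" "A \<subseteq> {1..cls_length C X}" by blast+
qed

section \<open>The measure as a maximum, and its recursion\<close>

text \<open>All sets of lengths lie in \<open>{1..cls_length C X}\<close>, so there are finitely
  many of them, however many chains there are. Antisymmetry makes the maximum unique, as the
  description \<open>THE\<close> requires.\<close>

lemma GR_measure_greatest:
  assumes X: "X \<in> ind C"
  shows "GR_measure C X \<in> chain_lengths C X"
    "A \<in> chain_lengths C X \<Longrightarrow> lex_le A (GR_measure C X)"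
proof -
  have "chain_lengths C X \<subseteq> Pow {1..cls_length C X}" using chain_lengths_bounds[OF X] by blast
  then have "finite (chain_lengths C X)" by (rule finite_subset) simp
  moreover have "chain_lengths C X \<noteq> {}"
    using chain_lengths_rec[OF X, of "{cls_length C X}"] by blast
  ultimately obtain M where M: "M \<in> chain_lengths C X" "\<forall>N \<in> chain_lengths C X. lex_le N M"
    using finite_lex_max by blast
  have "GR_measure C X = M"
    unfolding GR_measure_def
  proof (rule the_equality)
    show "M \<in> chain_lengths C X \<and> (\<forall>N \<in> chain_lengths C X. lex_le N M)" using M by blast
    fix M' assume M': "M' \<in> chain_lengths C X \<and> (\<forall>N \<in> chain_lengths C X. lex_le N M')"
    show "M' = M" by (rule lex_le_antisym) (use M M' in blast)+
  qed
  then show "GR_measure C X \<in> chain_lengths C X"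
    "A \<in> chain_lengths C X \<Longrightarrow> lex_le A (GR_measure C X)"
    using M by simp_all
qed

lemma GR_measure_bounds:
  assumes "X \<in> ind C"
  shows "cls_length C X \<in> GR_measure C X" "GR_measure C X \<subseteq> {1..cls_length C X}"
  using chain_lengths_bounds[OF assms GR_measure_greatest(1)[OF assms]] .

lemma GR_measure_insert_le:
  assumes "X \<in> ind C" "Y \<in> ind C" "cls_ssub C Y X"
  shows "lex_le (insert (cls_length C X) (GR_measure C Y)) (GR_measure C X)"
proof (rule GR_measure_greatest(2)[OF assms(1)])
  show "insert (cls_length C X) (GR_measure C Y) \<in> chain_lengths C X"
    using chain_lengths_rec[OF assms(1)] GR_measure_greatest(1)[OF assms(2)] assms(2,3) by blast
qed

lemma GR_measure_ssub_bound:
  assumes "X \<in> ind C" "Y \<in> ind C" "cls_ssub C Y X"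
  shows "\<forall>a \<in> GR_measure C Y. a < cls_length C X"
proof
  fix a assume "a \<in> GR_measure C Y"
  then have "a \<le> cls_length C Y" using GR_measure_bounds(2)[OF assms(2)] by auto
  then show "a < cls_length C X" using cls_length_less[OF assms(2,1,3)] by simp
qed

text \<open>A chain for \<open>Y\<close> can be extended by \<open>X\<close>, which only adds an
  element. Equality is excluded because l(X) belongs to the measure of \<open>X\<close> but exceeds
  every element of that of \<open>Y\<close>.\<close>

lemma GR_measure_ssub_less:
  assumes "X \<in> ind C" "Y \<in> ind C" "cls_ssub C Y X"
  shows "lex_less (GR_measure C Y) (GR_measure C X)"
proof -
  have "lex_le (GR_measure C Y) (insert (cls_length C X) (GR_measure C Y))"
    by (rule subset_imp_lex_le) blast
  then have "lex_le (GR_measure C Y) (GR_measure C X)"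
    using GR_measure_insert_le[OF assms] by (rule lex_le_trans)
  moreover have "GR_measure C Y \<noteq> GR_measure C X"
    using GR_measure_ssub_bound[OF assms] GR_measure_bounds(1)[OF assms(1)] by auto
  ultimately show ?thesis by (simp add: lex_le_iff)
qed

lemma GR_measure_cases:
  assumes X: "X \<in> ind C"
  obtains A where "GR_measure C X = insert (cls_length C X) A" "\<forall>a \<in> A. a < cls_length C X"
    "A = {} \<or> (\<exists>Y \<in> ind C. cls_ssub C Y X \<and> A = GR_measure C Y)"
proof -
  consider "GR_measure C X = {cls_length C X}"
    | Y B where "Y \<in> ind C" "B \<in> chain_lengths C Y" "cls_ssub C Y X"
        "GR_measure C X = insert (cls_length C X) B"
    using chain_lengths_rec[OF X] GR_measure_greatest(1)[OF X] by blast
  then show ?thesis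
  proof cases
    case 1
    then show ?thesis using that[of "{}"] by simp
  next
    case 2
    note b = GR_measure_ssub_bound[OF X 2(1,3)]
    \<comment> \<open>Replacing \<open>B\<close> by the maximum for \<open>Y\<close> cannot lower
      the set, since the added length is larger than all elements involved. As the measure of
      \<open>X\<close> is already maximal, nothing changes.\<close>
    have "lex_le (GR_measure C X) (insert (cls_length C X) (GR_measure C Y))"
      using lex_le_insert_mono[OF GR_measure_greatest(2)[OF 2(1,2)] b] 2(4) by simp
    then have "GR_measure C X = insert (cls_length C X) (GR_measure C Y)"
      using GR_measure_insert_le[OF X 2(1,3)] by (rule lex_le_antisym)
    then show ?thesis using that[of "GR_measure C Y"] b 2(1,3) by blast
  qed
qed

text \<open>The measure determines the length, which is the content of (GR2).\<close>

lemma cls_length_eq_Max_GR_measure: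
  assumes "X \<in> ind C"
  shows "cls_length C X = Max (GR_measure C X)"
  using GR_measure_bounds[OF assms]
  by (intro Max_eqI[symmetric]) (auto intro: finite_subset)

section \<open>The induced relation is transitive and satisfies the axioms\<close>

lemma trans_GR_rel: "trans (GR_rel C)"
  by (auto simp: trans_def GR_rel_def intro: lex_le_trans)

lemma GR1_GR_rel: "GR1 C (GR_rel C)"
  unfolding GR1_def
proof (intro ballI impI)
  fix X Y assume XY: "X \<in> ind C" "Y \<in> ind C" "cls_sub C X Y"
  have "lex_le (GR_measure C X) (GR_measure C Y)"
  proof (cases "X = Y")
    case False
    then have "cls_ssub C X Y" using XY by (simp add: cls_ssub_def)
    then show ?thesis using GR_measure_ssub_less XY lex_less_imp_lex_le by blast
  qed (simp add: lex_le_iff)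
  then show "(X, Y) \<in> GR_rel C" using XY by (simp add: GR_rel_def)
qed

lemma GR2_GR_rel: "GR2 C (GR_rel C)"
  unfolding GR2_def
proof (intro ballI impI)
  fix X Y assume XY: "X \<in> ind C" "Y \<in> ind C" "mu_eq (GR_rel C) X Y"
  then have "GR_measure C X = GR_measure C Y"
    using lex_le_antisym[of "GR_measure C X" "GR_measure C Y"] by (simp add: mu_eq_def GR_rel_def)
  then show "cls_length C X = cls_length C Y"
    using cls_length_eq_Max_GR_measure[OF XY(1)] cls_length_eq_Max_GR_measure[OF XY(2)] by simp
qed

text \<open>Apart from l(X), the measure of \<open>X\<close> is empty or the measure of a proper
  subobject, hence strictly below that of \<open>Y\<close>. Adding l(X) cannot overtake the measure
  of \<open>Y\<close>, because no element of the latter exceeds l(X).\<close>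

lemma GR3_GR_rel: "GR3 C (GR_rel C)"
  unfolding GR3_def
proof (intro ballI impI, elim conjE)
  fix X Y
  assume X: "X \<in> ind C" and Y: "Y \<in> ind C"
    and sub: "\<forall>X' \<in> ind C. cls_ssub C X' X \<longrightarrow> mu_less (GR_rel C) X' Y"
    and le: "cls_length C Y \<le> cls_length C X"
  obtain A where A: "GR_measure C X = insert (cls_length C X) A" "\<forall>a \<in> A. a < cls_length C X"
      "A = {} \<or> (\<exists>X' \<in> ind C. cls_ssub C X' X \<and> A = GR_measure C X')"
    using GR_measure_cases[OF X] .
  have "lex_less A (GR_measure C Y)"
  proof (cases "A = {}")
    case True
    have "GR_measure C Y \<noteq> {}" using GR_measure_bounds(1)[OF Y] by blast
    then show ?thesis
      using True subset_imp_lex_le[of "{}" "GR_measure C Y"] lex_le_iff[of "{}" "GR_measure C Y"]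
      by auto
  next
    case False
    then obtain X' where X': "X' \<in> ind C" "cls_ssub C X' X" "A = GR_measure C X'" using A(3) by blast
    then have "mu_less (GR_rel C) X' Y" using sub by blast
    then have "\<not> lex_le (GR_measure C Y) (GR_measure C X')"
      using X'(1) Y by (auto simp: mu_less_def mu_eq_def GR_rel_def)
    then show ?thesis using X'(3) by (simp add: not_lex_le)
  qed
  moreover have "\<forall>b \<in> GR_measure C Y. b \<le> cls_length C X"
    using GR_measure_bounds(2)[OF Y] le by auto
  ultimately have "lex_le (GR_measure C X) (GR_measure C Y)"
    unfolding A(1) by (rule lex_less_imp_insert_le[OF _ A(2)])
  then show "(X, Y) \<in> GR_rel C" using X Y by (simp add: GR_rel_def)
qed

section \<open>Uniqueness\<close>

text \<open>The strict half has to be carried through the induction, since (GR3) asks for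
  \<open>mu_less R\<close> on the proper subobjects of \<open>X\<close>, and this includes a
  non-membership in \<open>R\<close>.\<close>

lemma GR_axioms_determine:
  assumes R: "trans R" "GR1 C R" "GR2 C R" "GR3 C R"
    and XY: "X \<in> ind C" "Y \<in> ind C" "lex_le (GR_measure C X) (GR_measure C Y)"
  shows "(X, Y) \<in> R \<and> (lex_less (GR_measure C X) (GR_measure C Y) \<longrightarrow> (Y, X) \<notin> R)"
  using XY
proof (induction "cls_length C X + cls_length C Y" arbitrary: X Y rule: less_induct)
  case less
  note X = less.prems(1) and Y = less.prems(2) and le = less.prems(3)
  obtain B where B: "GR_measure C Y = insert (cls_length C Y) B" "\<forall>b \<in> B. b < cls_length C Y"
      "B = {} \<or> (\<exists>Y' \<in> ind C. cls_ssub C Y' Y \<and> B = GR_measure C Y')"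
    using GR_measure_cases[OF Y] .
  show ?case
  proof (cases "lex_le (GR_measure C X) B")
    case True
    \<comment> \<open>Only the empty set is below the empty set, but the measure of \<open>X\<close>
      contains l(X).\<close>
    then have "B \<noteq> {}" using GR_measure_bounds(1)[OF X] lex_le_empty_iff by blast
    then obtain Y' where Y': "Y' \<in> ind C" "cls_ssub C Y' Y" "B = GR_measure C Y'" using B(3) by blast
    have l: "cls_length C Y' < cls_length C Y" using cls_length_less[OF Y'(1) Y Y'(2)] .
    then have XY': "(X, Y') \<in> R" using less.hyps[OF _ X Y'(1)] True Y'(3) by simp
    have Y'Y: "(Y', Y) \<in> R" using R(2) Y Y'(1,2) by (simp add: GR1_def cls_ssub_def)
    \<comment> \<open>Otherwise \<open>Y\<close> and \<open>Y'\<close> would be equivalent under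
      \<open>R\<close>, and (GR2) would give them equal length.\<close>
    have "(Y, X) \<notin> R"
    proof
      assume "(Y, X) \<in> R"
      then have "(Y, Y') \<in> R" using XY' R(1) by (meson transD)
      then have "cls_length C Y' = cls_length C Y"
        using R(3) Y Y'(1) Y'Y unfolding GR2_def mu_eq_def by blast
      then show False using l by simp
    qed
    moreover have "(X, Y) \<in> R" using XY' Y'Y R(1) by (meson transD)
    ultimately show ?thesis by blast
  next
    case False
    \<comment> \<open>If l(X) were at most l(Y), all elements of the measure of \<open>X\<close>
      would be at most l(Y), and removing l(Y) on the right would leave the measure of
      \<open>X\<close> below \<open>B\<close>, the case already excluded.\<close>
    have lt: "cls_length C Y < cls_length C X" if "lex_less (GR_measure C X) (GR_measure C Y)"
    proof (rule ccontr)
      assume "\<not> ?thesis"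
      then have "\<forall>a \<in> GR_measure C X. a \<le> cls_length C Y"
        using GR_measure_bounds(2)[OF X] by fastforce
      then have "lex_le (GR_measure C X) B"
        using that lex_less_insertD[OF _ _ B(2)] unfolding B(1) by blast
      then show False using False by blast
    qed
    have "cls_length C Y \<le> cls_length C X"
    proof (cases "GR_measure C X = GR_measure C Y")
      case True
      then show ?thesis
        using cls_length_eq_Max_GR_measure[OF X] cls_length_eq_Max_GR_measure[OF Y] by simp
    next
      case False
      then show ?thesis using lt le by (simp add: lex_le_iff)
    qed
    \<comment> \<open>The induction hypothesis applies to \<open>X'\<close> and \<open>Y\<close>
      because \<open>X'\<close> is shorter than \<open>X\<close>; both of its halves are
      used.\<close>
    moreover have "mu_less R X' Y" if X': "X' \<in> ind C" "cls_ssub C X' X" for X'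
    proof -
      have "lex_less (GR_measure C X') (GR_measure C Y)"
        using GR_measure_ssub_less[OF X X'] le by (rule lex_less_le_trans)
      then have "(X', Y) \<in> R" "(Y, X') \<notin> R"
        using less.hyps[OF _ X'(1) Y lex_less_imp_lex_le] cls_length_less[OF X'(1) X X'(2)] by auto
      then show ?thesis by (simp add: mu_less_def mu_eq_def)
    qed
    ultimately have "(X, Y) \<in> R" using R(4) X Y unfolding GR3_def by blast
    moreover have "(Y, X) \<notin> R" if "lex_less (GR_measure C X) (GR_measure C Y)"
    proof
      assume "(Y, X) \<in> R"
      then have "cls_length C X = cls_length C Y"
        using R(3) X Y \<open>(X, Y) \<in> R\<close> unfolding GR2_def mu_eq_def by blast
      then show False using lt that by simp
    qed
    ultimately show ?thesis by blast
  qed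
qed

text \<open>The order on measures is total. When the measure of \<open>X\<close> is not below that
  of \<open>Y\<close>, the strict half for the swapped pair shows that \<open>(X, Y)\<close> is not
  in \<open>R\<close>.\<close>

lemma GR_axioms_imp_eq_GR_rel:
  assumes "R \<subseteq> ind C \<times> ind C" "trans R" "GR1 C R" "GR2 C R" "GR3 C R"
  shows "R = GR_rel C"
proof -
  have "(X, Y) \<in> R \<longleftrightarrow> (X, Y) \<in> GR_rel C" if "X \<in> ind C" "Y \<in> ind C" for X Y
  proof (cases "lex_le (GR_measure C X) (GR_measure C Y)")
    case True
    then show ?thesis using that GR_axioms_determine[OF assms(2-5) that] by (simp add: GR_rel_def)
  next
    case False
    then have "lex_less (GR_measure C Y) (GR_measure C X)" by (simp add: not_lex_le)
    then have "(X, Y) \<notin> R"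
      using GR_axioms_determine[OF assms(2-5) that(2,1)] lex_less_imp_lex_le by simp
    then show ?thesis using False by (simp add: GR_rel_def)
  qed
  moreover have "GR_rel C \<subseteq> ind C \<times> ind C" by (auto simp: GR_rel_def)
  ultimately show ?thesis using assms(1) by blast
qed

lemma GR_measure_in_Ch: "X \<in> ind C \<Longrightarrow> GR_measure C X \<in> Ch"
  using GR_measure_bounds(2)[of X] by (auto simp: Ch_def intro: finite_subset)

end

theorem mainTheorem2:
  fixes C :: "('o, 'm, 'z) ab_cat_scheme"
  assumes "abelian_length_category C"
  shows "GR_measure C \<in> ind C \<rightarrow> Ch \<and>
    (trans (GR_rel C) \<and> GR1 C (GR_rel C) \<and> GR2 C (GR_rel C) \<and> GR3 C (GR_rel C)) \<and>
    (\<forall>R. R \<subseteq> ind C \<times> ind C \<and> trans R \<and> GR1 C R \<and> GR2 C R \<and> GR3 C R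
      \<longrightarrow> R = GR_rel C)"
proof -
  interpret abelian_length_category C by fact
  show ?thesis
    using GR_measure_in_Ch trans_GR_rel GR1_GR_rel GR2_GR_rel GR3_GR_rel GR_axioms_imp_eq_GR_rel
    by blast
qed

end
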